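(* If $X$ is an infinite dimensional Banach lattice with a positive Schauder basis $\{e_i\}$, then the positive cone $X_+$ of $X$ contains a strongly reflexive cone $P$ such that $\overline{P-P}=X$.
   Context: All spaces are real. $B_X$ is the closed unit ball of $X$. A cone of $X$ is a nonempty convex set $P\subseteq X$ with $\lambda P\subseteq P$ for every real $\lambda\ge 0$. A cone $P$ of a Banach space $X$ is strongly reflexive if $P\cap B_X$ is norm compact. A Schauder basis $\{e_i\}$ of a Banach lattice $X$ is a positive basis if the positive cone $X_+$ of $X$ coincides with the positive cone of the basis, $\{\sum_{i=1}^\infty\lambda_i e_i : \lambda_i\ge 0 \text{ for any } i\}$ (convergent series in $X$). The closure is in the norm topology. *)

theory Defs
  imports "HOL-Analysis.Analysis" "HOL-Library.Lattice_Algebras"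
begin

class banach_lattice = banach + ordered_real_vector + lattice_ab_group_add_abs +
  assumes norm_mono_abs: "\<bar>x\<bar> \<le> \<bar>y\<bar> \<Longrightarrow> norm x \<le> norm y"

definition schauder_basis :: "(nat \<Rightarrow> 'a::banach) \<Rightarrow> bool"
  where "schauder_basis e \<longleftrightarrow> (\<forall>x. \<exists>!c :: nat \<Rightarrow> real. (\<lambda>i. c i *\<^sub>R e i) sums x)"

definition basis_cone :: "(nat \<Rightarrow> 'a::real_normed_vector) \<Rightarrow> 'a set"
  where "basis_cone e = {x. \<exists>c :: nat \<Rightarrow> real. (\<forall>i. 0 \<le> c i) \<and> (\<lambda>i. c i *\<^sub>R e i) sums x}"

definition positive_basis :: "(nat \<Rightarrow> 'a::banach_lattice) \<Rightarrow> bool"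
  where "positive_basis e \<longleftrightarrow> schauder_basis e \<and> {x. 0 \<le> x} = basis_cone e"

definition strongly_reflexive :: "'a::banach set \<Rightarrow> bool"
  where "strongly_reflexive P \<longleftrightarrow> convex_cone P \<and> compact (P \<inter> cball 0 1)"

end

theory Submission
  imports Defs
begin

text \<open>
  Every cone generated by a nonempty norm compact convex set \<open>K\<close> that misses the origin is strongly
  reflexive: a lower bound \<open>m > 0\<close> for the norm on \<open>K\<close> bounds the factor \<open>c\<close> of every \<open>c *\<^sub>R x\<close>,
  \<open>x \<in> K\<close>, in the unit ball by \<open>1 / m\<close>, so that the part of the cone in the ball lies in the compact
  set \<open>[0, 1 / m] K\<close> (\<open>strongly_reflexive_conic_hull\<close>). Hence it suffices to find such a \<open>K\<close> in the
  positive cone that is large enough for the differences of its points to span a dense subspace.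

  Scale the basis vectors to \<open>u n = t n *\<^sub>R e n\<close> with \<open>t n > 0\<close> and \<open>norm (u n) = (1 / 2) ^ n\<close>, and let
  \<open>K\<close> consist of the points \<open>e 0 + (\<Sum>n. a n *\<^sub>R u n)\<close> with coefficients \<open>a n\<close> in \<open>[0, 1]\<close>. The
  series converges uniformly in \<open>a\<close>, so \<open>K\<close> is a continuous image of the Hilbert cube and thus compact
  (\<open>compact_series_zonotope\<close>). The shift by \<open>e 0\<close> keeps \<open>K\<close> away from the origin, and this is where
  the lattice norm enters: each \<open>x \<in> K\<close> satisfies \<open>0 \<le> e 0 \<le> x\<close>, hence \<open>norm x \<ge> norm (e 0) > 0\<close>.
  Finally, \<open>u n\<close> is the difference of the points \<open>e 0 + u n\<close> and \<open>e 0\<close> of \<open>K\<close>. So the subspace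
  \<open>P - P\<close> contains every \<open>e n\<close>, and it is dense because the basis expansion of a vector
  is a limit of finite linear combinations of the \<open>e n\<close>.
\<close>

section \<open>Cones with a compact base\<close>

lemma strongly_reflexive_conic_hull:
  fixes K :: "'a::banach set"
  assumes "compact K" "convex K" "K \<noteq> {}" "0 \<notin> K"
  shows "strongly_reflexive (conic hull K)"
proof -
  obtain z where z: "z \<in> K" "\<And>x. x \<in> K \<Longrightarrow> norm z \<le> norm x"
    using continuous_attains_inf[OF assms(1,3) continuous_on_norm_id] by auto
  define m where "m = norm z"
  have m: "m > 0" "\<And>x. x \<in> K \<Longrightarrow> m \<le> norm x"
    using z assms(4) by (auto simp: m_def)
  define C where "C = (\<lambda>(c, x). c *\<^sub>R x) ` ({0..1 / m} \<times> K)"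
  have "compact C"
    unfolding C_def case_prod_unfold
    by (intro compact_continuous_image continuous_intros compact_Times assms compact_Icc)
  have "conic hull K \<inter> cball 0 1 = C \<inter> cball 0 1"
  proof (intro equalityI subsetI)
    fix y assume y: "y \<in> conic hull K \<inter> cball 0 1"
    then obtain c x where cx: "y = c *\<^sub>R x" "0 \<le> c" "x \<in> K"
      by (auto simp: conic_hull_explicit)
    have "c * m \<le> c * norm x"
      using m(2) cx by (intro mult_left_mono) auto
    also have "\<dots> \<le> 1"
      using y cx by auto
    finally have "c \<le> 1 / m"
      using m(1) by (simp add: field_simps)
    then show "y \<in> C \<inter> cball 0 1"
      using y cx by (auto simp: C_def)
  next
    fix y assume y: "y \<in> C \<inter> cball 0 1"
    then obtain c x where "y = c *\<^sub>R x" "0 \<le> c" "x \<in> K"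
      by (auto simp: C_def)
    then show "y \<in> conic hull K \<inter> cball 0 1"
      using y unfolding conic_hull_explicit by blast
  qed
  then have "compact (conic hull K \<inter> cball 0 1)"
    using \<open>compact C\<close> by (simp add: compact_Int_closed)
  moreover have "convex_cone (conic hull K)"
    using assms(2,3) by (simp add: convex_cone_def convex_conic_hull conic_conic_hull conic_hull_eq_empty)
  ultimately show ?thesis
    by (simp add: strongly_reflexive_def)
qed

lemma subspace_convex_cone_differences:
  assumes "convex_cone P"
  shows "subspace {x - y |x y. x \<in> P \<and> y \<in> P}" (is "subspace ?D")
proof (rule subspaceI)
  show "0 \<in> ?D"
    using convex_cone_contains_0[OF assms] by force
next
  fix v w assume "v \<in> ?D" "w \<in> ?D"
  then obtain x y x' y' where "v = x - y" "w = x' - y'" "x \<in> P" "y \<in> P" "x' \<in> P" "y' \<in> P"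
    by blast
  then show "v + w \<in> ?D"
    using convex_cone_add[OF assms]
    by (intro CollectI exI[of _ "x + x'"] exI[of _ "y + y'"]) auto
next
  fix c v assume "v \<in> ?D"
  then obtain x y where v: "v = x - y" "x \<in> P" "y \<in> P"
    by blast
  show "c *\<^sub>R v \<in> ?D"
  proof (cases "0 \<le> c")
    case True
    then have "c *\<^sub>R x \<in> P" "c *\<^sub>R y \<in> P"
      using v convex_cone_scaleR[OF assms] by auto
    moreover have "c *\<^sub>R v = c *\<^sub>R x - c *\<^sub>R y"
      by (simp add: v scaleR_diff_right)
    ultimately show ?thesis
      by blast
  next
    case False
    then have "(- c) *\<^sub>R y \<in> P" "(- c) *\<^sub>R x \<in> P"
      using v by (auto intro!: convex_cone_scaleR[OF assms] simp del: scaleR_minus_left)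
    moreover have "c *\<^sub>R v = (- c) *\<^sub>R y - (- c) *\<^sub>R x"
      by (simp add: v scaleR_diff_right)
    ultimately show ?thesis
      by blast
  qed
qed

section \<open>Zonotopes with infinitely many summable generators\<close>

definition series_zonotope :: "(nat \<Rightarrow> 'a::banach) \<Rightarrow> 'a set"
  where "series_zonotope u = {\<Sum>n. a n *\<^sub>R u n |a. \<forall>n. a n \<in> {0..1}}"

lemma norm_zonotope_term_le:
  fixes v :: "'a::real_normed_vector"
  shows "a \<in> {0..1} \<Longrightarrow> norm (a *\<^sub>R v) \<le> norm v"
  by (simp add: mult_left_le_one_le)

lemma summable_zonotope_series:
  fixes u :: "nat \<Rightarrow> 'a::banach"
  assumes "summable (\<lambda>n. norm (u n))" "\<And>n. a n \<in> {0..1}"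
  shows "summable (\<lambda>n. a n *\<^sub>R u n)"
  using norm_zonotope_term_le assms by (intro summable_comparison_test'[OF assms(1), of 0]) blast

text \<open>
  The coefficient sequences form the Hilbert cube, compact by Tychonoff's theorem in the topology
  of coordinatewise convergence. Each partial sum depends continuously on finitely many
  coordinates, and the Weierstrass test makes the convergence uniform.
\<close>

lemma compact_series_zonotope:
  fixes u :: "nat \<Rightarrow> 'a::banach"
  assumes "summable (\<lambda>n. norm (u n))"
  shows "compact (series_zonotope u)"
proof -
  define Q :: "(nat \<Rightarrow> real) set" where "Q = (\<Pi>\<^sub>E n\<in>UNIV. {0..1})"
  have "compactin (product_topology (\<lambda>_. euclidean) UNIV) Q"
    unfolding Q_def compactin_PiE by simp
  then have "compact Q"
    by (simp add: euclidean_product_topology)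
  have "uniform_limit Q (\<lambda>N a. \<Sum>n<N. a n *\<^sub>R u n) (\<lambda>a. \<Sum>n. a n *\<^sub>R u n) sequentially"
    by (rule Weierstrass_m_test[OF _ assms]) (auto simp: Q_def PiE_iff intro!: mult_left_le_one_le)
  moreover have "continuous_on Q (\<lambda>a. \<Sum>n<N. a n *\<^sub>R u n)" for N
    by (intro continuous_intros continuous_on_subset[OF continuous_on_product_coordinates]) auto
  ultimately have "continuous_on Q (\<lambda>a. \<Sum>n. a n *\<^sub>R u n)"
    by (intro uniform_limit_theorem[where F = sequentially]) auto
  then have "compact ((\<lambda>a. \<Sum>n. a n *\<^sub>R u n) ` Q)"
    using \<open>compact Q\<close> by (rule compact_continuous_image)
  also have "(\<lambda>a. \<Sum>n. a n *\<^sub>R u n) ` Q = series_zonotope u"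
    by (auto simp: series_zonotope_def Q_def PiE_iff)
  finally show ?thesis .
qed

lemma convex_series_zonotope:
  fixes u :: "nat \<Rightarrow> 'a::banach"
  assumes "summable (\<lambda>n. norm (u n))"
  shows "convex (series_zonotope u)"
proof (rule convexI)
  fix x y and s t :: real
  assume xy: "x \<in> series_zonotope u" "y \<in> series_zonotope u"
    and st: "0 \<le> s" "0 \<le> t" "s + t = 1"
  from xy obtain a b where a: "\<And>n. a n \<in> {0..1}" "x = (\<Sum>n. a n *\<^sub>R u n)"
    and b: "\<And>n. b n \<in> {0..1}" "y = (\<Sum>n. b n *\<^sub>R u n)"
    unfolding series_zonotope_def by blast
  define d where "d n = s * a n + t * b n" for n
  have "d n \<in> {0..1}" for n
    using convexD[OF convex_real_interval(5), of "a n" 0 1 "b n" s t] a(1) b(1) st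
    by (simp add: d_def)
  moreover have "(\<lambda>n. d n *\<^sub>R u n) sums (s *\<^sub>R x + t *\<^sub>R y)"
    unfolding d_def scaleR_add_left scaleR_scaleR[symmetric] a(2) b(2)
    by (intro sums_add sums_scaleR_right summable_sums summable_zonotope_series assms a b)
  then have "s *\<^sub>R x + t *\<^sub>R y = (\<Sum>n. d n *\<^sub>R u n)"
    by (simp add: sums_iff)
  ultimately show "s *\<^sub>R x + t *\<^sub>R y \<in> series_zonotope u"
    unfolding series_zonotope_def by blast
qed

lemma sums_unit_coefficient:
  fixes u :: "nat \<Rightarrow> 'a::real_normed_vector"
  shows "(\<lambda>n. (if n = k then 1 else 0) *\<^sub>R u n) sums u k"
proof -
  have "(\<lambda>n. (if n = k then 1 else 0) *\<^sub>R u n) = (\<lambda>n. if n = k then u n else 0)"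
    by auto
  then show ?thesis
    using sums_single[of k u] by simp
qed

lemma zero_in_series_zonotope: "0 \<in> series_zonotope u"
  unfolding series_zonotope_def by (intro CollectI exI[of _ "\<lambda>_. 0"]) simp

lemma generator_in_series_zonotope: "u k \<in> series_zonotope u"
proof -
  have "u k = (\<Sum>n. (if n = k then 1 else 0) *\<^sub>R u n)"
    using sums_unit_coefficient[of k u] by (simp add: sums_iff)
  then show ?thesis
    unfolding series_zonotope_def
    by (intro CollectI exI[of _ "\<lambda>n. if n = k then 1 else 0"]) simp
qed

section \<open>Schauder bases and positive bases\<close>

text \<open>
  If \<open>e n\<close> vanished, its coefficient in the expansion of \<open>0\<close> would be arbitrary, against uniqueness.
\<close>

lemma schauder_basis_nonzero:
  assumes "schauder_basis e"
  shows "e n \<noteq> 0"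
proof
  assume "e n = 0"
  then have "(\<lambda>i. (if i = n then 1 else 0) *\<^sub>R e i) sums 0"
    using sums_unit_coefficient[of n e] by simp
  moreover have "(\<lambda>i. 0 *\<^sub>R e i) sums 0"
    by simp
  moreover have "\<exists>\<^sub>\<le>\<^sub>1c. (\<lambda>i. c i *\<^sub>R e i) sums 0"
    using assms by (simp add: schauder_basis_def ex1_iff_ex_Uniq)
  ultimately have "(\<lambda>i. if i = n then 1 else 0 :: real) = (\<lambda>_. 0)"
    by (intro Uniq_D[where P = "\<lambda>c. (\<lambda>i. c i *\<^sub>R e i) sums 0"])
  from fun_cong[OF this, of n] show False
    by simp
qed

lemma schauder_basis_dense_subspace:
  assumes "schauder_basis e" "subspace S" "\<And>n. e n \<in> S"
  shows "closure S = UNIV"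
proof (intro equalityI subset_UNIV subsetI)
  fix x
  obtain c where "(\<lambda>i. c i *\<^sub>R e i) sums x"
    using assms(1) unfolding schauder_basis_def by blast
  moreover have "(\<Sum>i<N. c i *\<^sub>R e i) \<in> S" for N
    using assms by (intro subspace_sum subspace_scale)
  ultimately show "x \<in> closure S"
    unfolding closure_sequential sums_def
    by (intro exI[of _ "\<lambda>N. \<Sum>i<N. c i *\<^sub>R e i"]) blast
qed

lemma positive_basis_sums_nonneg:
  assumes "positive_basis e" "\<And>i. 0 \<le> c i" "(\<lambda>i. c i *\<^sub>R e i) sums x"
  shows "0 \<le> x"
  using assms unfolding positive_basis_def basis_cone_def by blast

lemma positive_basis_nonneg:
  assumes "positive_basis e"
  shows "0 \<le> e n"
proof (rule positive_basis_sums_nonneg[OF assms])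
  show "(\<lambda>i. (if i = n then 1 else 0) *\<^sub>R e i) sums e n"
    by (rule sums_unit_coefficient)
qed simp

lemma norm_mono_nonneg:
  fixes x y :: "'a::banach_lattice"
  assumes "0 \<le> x" "x \<le> y"
  shows "norm x \<le> norm y"
  using assms by (intro norm_mono_abs) simp

section \<open>A strongly reflexive cone with dense span\<close>

theorem theorem5p7:
  fixes e :: "nat \<Rightarrow> 'a::banach_lattice"
  assumes "\<nexists>B :: 'a set. finite B \<and> span B = UNIV"
    and "positive_basis e"
  shows "\<exists>P :: 'a set. P \<subseteq> {x. 0 \<le> x} \<and> strongly_reflexive P
           \<and> closure {x - y |x y. x \<in> P \<and> y \<in> P} = UNIV"
proof -
  have basis: "schauder_basis e"
    using assms(2) by (simp add: positive_basis_def)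
  define t where "t n = (1 / 2) ^ n / norm (e n)" for n
  define u where "u n = t n *\<^sub>R e n" for n
  have t_pos: "t n > 0" for n
    using schauder_basis_nonzero[OF basis] by (simp add: t_def)
  have "norm (u n) = (1 / 2) ^ n" for n
    using schauder_basis_nonzero[OF basis] by (simp add: u_def t_def)
  then have summable: "summable (\<lambda>n. norm (u n))"
    by (simp add: summable_geometric)
  define K where "K = (+) (e 0) ` series_zonotope u"
  have K_ge: "e 0 \<le> x" if "x \<in> K" for x
  proof -
    obtain a where a: "\<And>n. a n \<in> {0..1}" "x = e 0 + (\<Sum>n. a n *\<^sub>R u n)"
      using \<open>x \<in> K\<close> unfolding K_def series_zonotope_def by blast
    have "0 \<le> (\<Sum>n. a n *\<^sub>R u n)"
    proof (rule positive_basis_sums_nonneg[OF assms(2)])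
      show "0 \<le> a n * t n" for n
        using a(1)[of n] t_pos[of n] by simp
      show "(\<lambda>n. (a n * t n) *\<^sub>R e n) sums (\<Sum>n. a n *\<^sub>R u n)"
        using summable_sums[OF summable_zonotope_series[OF summable a(1)]] by (simp add: u_def)
    qed
    then show ?thesis
      by (simp add: a(2))
  qed
  have e0: "0 \<le> e 0"
    by (rule positive_basis_nonneg[OF assms(2)])
  have "0 \<notin> K"
  proof
    assume "0 \<in> K"
    then have "norm (e 0) \<le> norm (0 :: 'a)"
      by (intro norm_mono_nonneg e0 K_ge)
    then show False
      using schauder_basis_nonzero[OF basis] by simp
  qed
  define P where "P = conic hull K"
  have "K \<noteq> {}"
    using zero_in_series_zonotope by (auto simp: K_def)
  then have refl: "strongly_reflexive P"
    unfolding P_def using \<open>0 \<notin> K\<close> summable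
    by (intro strongly_reflexive_conic_hull)
      (auto simp: K_def compact_series_zonotope convex_series_zonotope
        intro!: compact_translation convex_translation)
  have nonneg: "P \<subseteq> {x. 0 \<le> x}"
    using order_trans[OF e0 K_ge]
    by (auto simp: P_def conic_hull_explicit intro: scaleR_nonneg_nonneg)
  let ?D = "{x - y |x y. x \<in> P \<and> y \<in> P}"
  have sub: "subspace ?D"
    using refl by (intro subspace_convex_cone_differences) (simp add: strongly_reflexive_def)
  have "e n \<in> ?D" for n
  proof -
    have "K \<subseteq> P"
      by (simp add: P_def hull_subset)
    moreover have "e 0 + u n \<in> K" "e 0 + 0 \<in> K"
      unfolding K_def using generator_in_series_zonotope zero_in_series_zonotope by blast+
    ultimately have "(e 0 + u n) - (e 0 + 0) \<in> ?D"
      by blast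
    then have "u n \<in> ?D"
      by simp
    then have "inverse (t n) *\<^sub>R u n \<in> ?D"
      by (rule subspace_scale[OF sub])
    then show ?thesis
      using t_pos[of n] by (simp add: u_def)
  qed
  then have "closure ?D = UNIV"
    by (rule schauder_basis_dense_subspace[OF basis sub])
  then show ?thesis
    using nonneg refl by blast
qed

end
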